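(* Let $A_1=(\mathcal{S}_1,\mathcal{E},\mathcal{I}_1,\mathcal{F}_1,\to_1)$ and $A_2=(\mathcal{S}_2,\mathcal{E},\mathcal{I}_2,\mathcal{F}_2,\to_2)$ be Büchi automata over the same set of events. For $X\subseteq\mathcal{S}_1\times\mathcal{S}_2$ define $$\texttt{fsim}^\texttt{R}_\texttt{delay}(X)\triangleq\mu Y.\ \{(s_1,s_2)\mid s_2\in\mathcal{F}_2\wedge\forall e.\forall s_1\xrightarrow{e}_1 s_1'.\exists s_2\xrightarrow{e}_2 s_2'.\ (s_1',s_2')\in X\}\ \cup\ \{(s_1,s_2)\mid \forall e.\forall s_1\xrightarrow{e}_1 s_1'.\exists s_2\xrightarrow{e}_2 s_2'.\ (s_1',s_2')\in Y\},$$ $$\texttt{fsim}^\texttt{L}_\texttt{delay}\triangleq\nu X.\ \texttt{fsim}^\texttt{R}_\texttt{delay}(X)\ \cup\ \{(s_1,s_2)\mid s_1\notin\mathcal{F}_1\wedge\forall e.\forall s_1\xrightarrow{e}_1 s_1'.\exists s_2\xrightarrow{e}_2 s_2'.\ (s_1',s_2')\in X\},$$ $$\texttt{wait}(X)\triangleq\mu Y.\ \{(s_1,s_2)\mid\forall e.\forall s_1\xrightarrow{e}_1 s_1'.\exists s_2\xrightarrow{e}_2 s_2'.\ (s_1',s_2')\in Y\}\ \cup\ X,$$ and the double delay simulation $\texttt{fsim}_\texttt{2delay}\triangleq\texttt{wait}(\texttt{fsim}^\texttt{L}_\texttt{delay})$. Then for all $(s_1,s_2)\in\texttt{fsim}_\texttt{2delay}$,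 $\mathcal{L}_{A_1}(s_1)\subseteq\mathcal{L}_{A_2}(s_2)$.
   Context: A Büchi automaton $(\mathcal{S},\mathcal{E},\mathcal{I},\mathcal{F},\to)$ consists of a set of states $\mathcal{S}$ (not necessarily finite), a set of events $\mathcal{E}$, initial states $\mathcal{I}\subseteq\mathcal{S}$, accepting states $\mathcal{F}\subseteq\mathcal{S}$, and a labeled transition relation $\to\subseteq\mathcal{S}\times\mathcal{E}\times\mathcal{S}$ (written $s\xrightarrow{e}s'$). $\nu$ and $\mu$ denote greatest and least fixed points of monotone operators on powerset lattices. The language of automaton $A$ is $\mathcal{L}_A\triangleq\nu L.\ \mu X.\ \{(s,e\cdot\tau)\mid \exists s\xrightarrow{e}s'.\ (s',\tau)\in X\}\cup\{(s,e\cdot\tau)\mid s\in\mathcal{F}\wedge \exists s\xrightarrow{e}s'.\ (s',\tau)\in L\}\subseteq\mathcal{S}\times\mathcal{E}^\omega$, and $\mathcal{L}_A(s)\triangleq\{\tau\mid (s,\tau)\in\mathcal{L}_A\}$. *)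

theory Defs
  imports Main "HOL-Library.Stream"
begin

record ('s, 'e) buchi =
  states :: "'s set"
  events :: "'e set"
  initial :: "'s set"
  accepting :: "'s set"
  trans_rel :: "('s \<times> 'e \<times> 's) set"

definition buchi_automaton :: "('s, 'e) buchi \<Rightarrow> bool" where
  "buchi_automaton A \<longleftrightarrow>
     initial A \<subseteq> states A \<and>
     accepting A \<subseteq> states A \<and>
     trans_rel A \<subseteq> states A \<times> events A \<times> states A"

text \<open>The fixed points below live in the powerset lattices of the carriers (states times
  streams of events, resp. pairs of states), whereas lfp and gfp range over all sets of the
  underlying type. Hence every operator carries an explicit restriction to the carrier; without
  it, the greatest fixed points for simulations would contain pairs of elements that are not
  states, because these have no outgoing transitions.\<close>

definition lang :: "('s, 'e) buchi \<Rightarrow> ('s \<times> 'e stream) set" where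
  "lang A = gfp (\<lambda>L. lfp (\<lambda>X.
     {(s, e ## \<tau>) | s e \<tau>. (s, e ## \<tau>) \<in> states A \<times> streams (events A) \<and>
        (\<exists>s'. (s, e, s') \<in> trans_rel A \<and> (s', \<tau>) \<in> X)} \<union>
     {(s, e ## \<tau>) | s e \<tau>. (s, e ## \<tau>) \<in> states A \<times> streams (events A) \<and>
        s \<in> accepting A \<and> (\<exists>s'. (s, e, s') \<in> trans_rel A \<and> (s', \<tau>) \<in> L)}))"

definition lang_of :: "('s, 'e) buchi \<Rightarrow> 's \<Rightarrow> 'e stream set" where
  "lang_of A s = {\<tau>. (s, \<tau>) \<in> lang A}"

definition fstep ::
  "('s1, 'e) buchi \<Rightarrow> ('s2, 'e) buchi \<Rightarrow> ('s1 \<times> 's2) set \<Rightarrow> ('s1 \<times> 's2) set" where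
  "fstep A1 A2 X = {(s1, s2). s1 \<in> states A1 \<and> s2 \<in> states A2 \<and>
     (\<forall>e s1'. (s1, e, s1') \<in> trans_rel A1 \<longrightarrow>
        (\<exists>s2'. (s2, e, s2') \<in> trans_rel A2 \<and> (s1', s2') \<in> X))}"

definition fsim_R_delay ::
  "('s1, 'e) buchi \<Rightarrow> ('s2, 'e) buchi \<Rightarrow> ('s1 \<times> 's2) set \<Rightarrow> ('s1 \<times> 's2) set" where
  "fsim_R_delay A1 A2 X = lfp (\<lambda>Y.
     {(s1, s2). s2 \<in> accepting A2 \<and> (s1, s2) \<in> fstep A1 A2 X} \<union> fstep A1 A2 Y)"

definition fsim_L_delay ::
  "('s1, 'e) buchi \<Rightarrow> ('s2, 'e) buchi \<Rightarrow> ('s1 \<times> 's2) set" where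
  "fsim_L_delay A1 A2 = gfp (\<lambda>X.
     fsim_R_delay A1 A2 X \<union>
     {(s1, s2). s1 \<notin> accepting A1 \<and> (s1, s2) \<in> fstep A1 A2 X})"

definition fsim_wait ::
  "('s1, 'e) buchi \<Rightarrow> ('s2, 'e) buchi \<Rightarrow> ('s1 \<times> 's2) set \<Rightarrow> ('s1 \<times> 's2) set" where
  "fsim_wait A1 A2 X = lfp (\<lambda>Y. fstep A1 A2 Y \<union> X)"

definition fsim_2delay ::
  "('s1, 'e) buchi \<Rightarrow> ('s2, 'e) buchi \<Rightarrow> ('s1 \<times> 's2) set" where
  "fsim_2delay A1 A2 = fsim_wait A1 A2 (fsim_L_delay A1 A2)"

end

theory Submission
  imports Defs
begin

text \<open>A run of the first automaton is followed along the simulation.  While the pair is justified by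
  the disjunct with a non-accepting left state, the inner least fixed point of the language of the
  first automaton decreases; as soon as the pair lies in the least fixed point
  \<open>fsim_R_delay\<close>, that one decreases until an accepting state of the second automaton is passed.
  Finitely many initial \<open>wait\<close> steps are harmless, because a language is closed under prepending
  transitions.\<close>

text \<open>The inner least fixed point of \<open>lang\<close>, with the outer variable as parameter
  \<open>L\<close>: finitely many transitions, the last one leaving an accepting state, after which
  \<open>L\<close> takes over. \<open>lang\<close> is the greatest fixed point of this
  operator.\<close>

definition lang_until :: "('s, 'e) buchi \<Rightarrow> ('s \<times> 'e stream) set \<Rightarrow> ('s \<times> 'e stream) set" where
  "lang_until A L = lfp (\<lambda>X.
     {(s, e ## \<tau>) | s e \<tau>. (s, e ## \<tau>) \<in> states A \<times> streams (events A) \<and>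
        (\<exists>s'. (s, e, s') \<in> trans_rel A \<and> (s', \<tau>) \<in> X)} \<union>
     {(s, e ## \<tau>) | s e \<tau>. (s, e ## \<tau>) \<in> states A \<times> streams (events A) \<and>
        s \<in> accepting A \<and> (\<exists>s'. (s, e, s') \<in> trans_rel A \<and> (s', \<tau>) \<in> L)})"

lemma lang_until_unfold:
  "lang_until A L =
     {(s, e ## \<tau>) | s e \<tau>. (s, e ## \<tau>) \<in> states A \<times> streams (events A) \<and>
        (\<exists>s'. (s, e, s') \<in> trans_rel A \<and> (s', \<tau>) \<in> lang_until A L)} \<union>
     {(s, e ## \<tau>) | s e \<tau>. (s, e ## \<tau>) \<in> states A \<times> streams (events A) \<and>
        s \<in> accepting A \<and> (\<exists>s'. (s, e, s') \<in> trans_rel A \<and> (s', \<tau>) \<in> L)}"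
  unfolding lang_until_def by (rule lfp_unfold) (rule monoI, blast)

lemma lang_until_step:
  assumes "s \<in> states A" "e ## \<tau> \<in> streams (events A)" "(s, e, s') \<in> trans_rel A"
    and "(s', \<tau>) \<in> lang_until A L"
  shows "(s, e ## \<tau>) \<in> lang_until A L"
  using assms by (subst lang_until_unfold) blast

lemma lang_until_accept:
  assumes "s \<in> states A" "e ## \<tau> \<in> streams (events A)" "(s, e, s') \<in> trans_rel A"
    and "s \<in> accepting A" "(s', \<tau>) \<in> L"
  shows "(s, e ## \<tau>) \<in> lang_until A L"
  using assms by (subst lang_until_unfold) blast

text \<open>Induction on the number of transitions up to the accepting one. The step case retains
  membership in \<open>lang_until A L\<close> next to \<open>P\<close>, from which the simulation
  argument recovers that the current word is in the language.\<close>

lemma lang_until_induct [consumes 1, case_names step accept]: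
  assumes major: "(s, \<tau>) \<in> lang_until A L"
    and step: "\<And>s e \<tau> s'. \<lbrakk>s \<in> states A; e ## \<tau> \<in> streams (events A); (s, e, s') \<in> trans_rel A;
      (s', \<tau>) \<in> lang_until A L; P s' \<tau>\<rbrakk> \<Longrightarrow> P s (e ## \<tau>)"
    and accept: "\<And>s e \<tau> s'. \<lbrakk>s \<in> states A; e ## \<tau> \<in> streams (events A); (s, e, s') \<in> trans_rel A;
      s \<in> accepting A; (s', \<tau>) \<in> L\<rbrakk> \<Longrightarrow> P s (e ## \<tau>)"
  shows "P s \<tau>"
proof -
  have "lang_until A L \<subseteq> {(s, \<tau>). (s, \<tau>) \<in> lang_until A L \<and> P s \<tau>}"
    \<comment> \<open>Only the left occurrence is unfolded; the one inside the comprehension must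
      stay folded to supply the retained membership.\<close>
    by (subst (1) lang_until_def, rule lfp_lowerbound)
      (auto intro: lang_until_step lang_until_accept step accept)
  then show ?thesis using major by blast
qed

lemma lang_until_mono: "mono (lang_until A)"
  unfolding lang_until_def by (intro monoI lfp_mono) blast

lemma lang_eq_gfp: "lang A = gfp (lang_until A)"
  unfolding lang_def lang_until_def ..

lemma lang_unfold: "lang A = lang_until A (lang A)"
  unfolding lang_eq_gfp by (rule gfp_unfold[OF lang_until_mono])

lemma lang_step:
  assumes "s \<in> states A" "e ## \<tau> \<in> streams (events A)" "(s, e, s') \<in> trans_rel A"
    and "(s', \<tau>) \<in> lang A"
  shows "(s, e ## \<tau>) \<in> lang A"
  using lang_until_step[of s A e \<tau> s' "lang A"] assms by (simp flip: lang_unfold)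

text \<open>Both disjuncts of the unfolding lead to a successor in \<open>lang A\<close>, since
  \<open>lang_until A (lang A)\<close> is \<open>lang A\<close> itself; whether \<open>s\<close> was
  accepting is forgotten.\<close>

lemma lang_cases:
  assumes "(s, \<tau>) \<in> lang A"
  obtains e \<tau>' s' where "\<tau> = e ## \<tau>'" "e ## \<tau>' \<in> streams (events A)" "(s, e, s') \<in> trans_rel A"
    "(s', \<tau>') \<in> lang A"
proof -
  have "(s, \<tau>) \<in> lang_until A (lang A)"
    using assms by (simp flip: lang_unfold)
  then show thesis
    using that by (subst (asm) lang_until_unfold) (auto simp flip: lang_unfold)
qed

lemma fstepE:
  assumes "(s1, s2) \<in> fstep A1 A2 X" "(s1, e, s1') \<in> trans_rel A1"
  obtains s2' where "s2 \<in> states A2" "(s2, e, s2') \<in> trans_rel A2" "(s1', s2') \<in> X"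
  using assms unfolding fstep_def by blast

lemma fstep_mono: "X \<subseteq> Y \<Longrightarrow> fstep A1 A2 X \<subseteq> fstep A1 A2 Y"
  unfolding fstep_def by blast

lemma fsim_R_delay_induct [consumes 1, case_names accept step]:
  assumes major: "(s1, s2) \<in> fsim_R_delay A1 A2 X"
    and accept: "\<And>s1 s2. s2 \<in> accepting A2 \<Longrightarrow> (s1, s2) \<in> fstep A1 A2 X \<Longrightarrow> P s1 s2"
    and step: "\<And>s1 s2. (s1, s2) \<in> fstep A1 A2 {(t1, t2). P t1 t2} \<Longrightarrow> P s1 s2"
  shows "P s1 s2"
proof -
  have "fsim_R_delay A1 A2 X \<subseteq> {(t1, t2). P t1 t2}"
    unfolding fsim_R_delay_def by (rule lfp_lowerbound) (auto intro: accept step)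
  then show ?thesis using major by blast
qed

lemma fsim_R_delay_mono: "X \<subseteq> Y \<Longrightarrow> fsim_R_delay A1 A2 X \<subseteq> fsim_R_delay A1 A2 Y"
  unfolding fsim_R_delay_def using fstep_mono[of X Y A1 A2] by (intro lfp_mono) blast

lemma fsim_L_delay_unfold:
  "fsim_L_delay A1 A2 = fsim_R_delay A1 A2 (fsim_L_delay A1 A2) \<union>
     {(s1, s2). s1 \<notin> accepting A1 \<and> (s1, s2) \<in> fstep A1 A2 (fsim_L_delay A1 A2)}"
  unfolding fsim_L_delay_def
proof (rule gfp_unfold, rule monoI)
  fix X Y :: "('a \<times> 'b) set"
  assume "X \<subseteq> Y"
  then show "fsim_R_delay A1 A2 X \<union> {(s1, s2). s1 \<notin> accepting A1 \<and> (s1, s2) \<in> fstep A1 A2 X}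
    \<subseteq> fsim_R_delay A1 A2 Y \<union> {(s1, s2). s1 \<notin> accepting A1 \<and> (s1, s2) \<in> fstep A1 A2 Y}"
    using fsim_R_delay_mono[of X Y A1 A2] fstep_mono[of X Y A1 A2] by blast
qed

text \<open>Induction on \<open>fsim_R_delay\<close>: each transition of the first run is answered
  by the second automaton, until the latter leaves an accepting state and the pair reached lies in
  \<open>X\<close>. The set passed to \<open>lang_until\<close> records exactly this
  outcome.\<close>

lemma fsim_R_delay_lang_until:
  assumes ev: "events A1 = events A2"
    and "(s1, s2) \<in> fsim_R_delay A1 A2 X" "(s1, \<tau>) \<in> lang A1"
  shows "(s2, \<tau>) \<in> lang_until A2 {(s2, \<tau>). \<exists>s1. (s1, s2) \<in> X \<and> (s1, \<tau>) \<in> lang A1}"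
  using assms(2,3)
proof (induction arbitrary: \<tau> rule: fsim_R_delay_induct)
  case (accept s1 s2)
  from accept.prems obtain e \<tau>' s1' where t: "\<tau> = e ## \<tau>'" "e ## \<tau>' \<in> streams (events A1)"
    "(s1, e, s1') \<in> trans_rel A1" "(s1', \<tau>') \<in> lang A1"
    by (rule lang_cases)
  with accept.hyps show ?case
    by (auto simp: ev elim!: fstepE intro: lang_until_accept)
next
  case (step s1 s2)
  from step.prems obtain e \<tau>' s1' where t: "\<tau> = e ## \<tau>'" "e ## \<tau>' \<in> streams (events A1)"
    "(s1, e, s1') \<in> trans_rel A1" "(s1', \<tau>') \<in> lang A1"
    by (rule lang_cases)
  with step.IH show ?case
    by (auto simp: ev elim!: fstepE intro: lang_until_step)
qed

text \<open>Coinduction for the language of the second automaton, with a nested induction on the way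
  to the next accepting state of the first.\<close>

lemma fsim_L_delay_lang:
  assumes ev: "events A1 = events A2"
    and "(s1, s2) \<in> fsim_L_delay A1 A2" "(s1, \<tau>) \<in> lang A1"
  shows "(s2, \<tau>) \<in> lang A2"
proof -
  let ?S = "fsim_L_delay A1 A2"
  \<comment> \<open>The coinduction candidate: all words that some simulated state of the first
    automaton accepts.\<close>
  let ?L = "{(s2, \<tau>). \<exists>s1. (s1, s2) \<in> ?S \<and> (s1, \<tau>) \<in> lang A1}"
  \<comment> \<open>The premise is \<open>lang A1\<close> unfolded once, which makes the inner least
    fixed point available for induction.\<close>
  have main: "(s2, \<tau>) \<in> lang_until A2 ?L"
    if "(s1, \<tau>) \<in> lang_until A1 (lang A1)" "(s1, s2) \<in> ?S" for s1 s2 \<tau>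
    using that
  proof (induction arbitrary: s2 rule: lang_until_induct)
    case (step s e \<tau> s')
    have "(s, e ## \<tau>) \<in> lang A1"
      using step.hyps by (intro lang_step) (simp_all flip: lang_unfold)
    moreover from step.prems
    have "(s, s2) \<in> fsim_R_delay A1 A2 ?S \<or> (s, s2) \<in> fstep A1 A2 ?S"
      by (subst (asm) fsim_L_delay_unfold) blast
    ultimately show ?case
    proof (elim disjE)
      assume "(s, s2) \<in> fstep A1 A2 ?S"
      then obtain s2' where "s2 \<in> states A2" "(s2, e, s2') \<in> trans_rel A2" "(s', s2') \<in> ?S"
        using step.hyps by (blast elim: fstepE)
      with step show ?thesis by (auto simp: ev intro: lang_until_step)
    qed (rule fsim_R_delay_lang_until[OF ev])
  next
    case (accept s e \<tau> s')
    have "(s, e ## \<tau>) \<in> lang A1"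
      using accept.hyps by (intro lang_step)
    \<comment> \<open>An accepting \<open>s\<close> rules out the second disjunct of the simulation,
      so the pair is in \<open>fsim_R_delay\<close>, which forces an accepting state on the
      right.\<close>
    moreover from accept.prems accept.hyps have "(s, s2) \<in> fsim_R_delay A1 A2 ?S"
      by (subst (asm) fsim_L_delay_unfold) blast
    ultimately show ?case by (rule fsim_R_delay_lang_until[OF ev, rotated])
  qed
  \<comment> \<open>\<open>main\<close> says that \<open>?L\<close> is a post-fixed point of
    \<open>lang_until A2\<close>.\<close>
  have "?L \<subseteq> lang A2"
    unfolding lang_eq_gfp[of A2]
    by (rule gfp_upperbound) (use main in \<open>auto simp flip: lang_unfold\<close>)
  then show ?thesis using assms by blast
qed

text \<open>Language inclusion, as a relation \<open>?Y\<close> on states, is closed under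
  \<open>fstep\<close>: one matched transition is prepended to both words. With \<open>X\<close>
  inside \<open>?Y\<close>, the least fixed point is inside as well.\<close>

lemma fsim_wait_lang:
  assumes ev: "events A1 = events A2"
    and X: "\<And>s1 s2 \<tau>. (s1, s2) \<in> X \<Longrightarrow> (s1, \<tau>) \<in> lang A1 \<Longrightarrow> (s2, \<tau>) \<in> lang A2"
    and "(s1, s2) \<in> fsim_wait A1 A2 X"
  shows "lang_of A1 s1 \<subseteq> lang_of A2 s2"
proof -
  let ?Y = "{(s1, s2). lang_of A1 s1 \<subseteq> lang_of A2 s2}"
  have "fstep A1 A2 ?Y \<subseteq> ?Y"
  proof clarify
    fix s1 s2 \<tau>
    assume s: "(s1, s2) \<in> fstep A1 A2 ?Y" and "\<tau> \<in> lang_of A1 s1"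
    then have "(s1, \<tau>) \<in> lang A1" by (simp add: lang_of_def)
    then obtain e \<tau>' s1' where t: "\<tau> = e ## \<tau>'" "e ## \<tau>' \<in> streams (events A1)"
      "(s1, e, s1') \<in> trans_rel A1" "(s1', \<tau>') \<in> lang A1"
      by (rule lang_cases)
    from s t(3) obtain s2' where s2': "s2 \<in> states A2" "(s2, e, s2') \<in> trans_rel A2"
      "(s1', s2') \<in> ?Y"
      by (rule fstepE)
    with t have "(s2', \<tau>') \<in> lang A2" by (auto simp: lang_of_def)
    with t s2' show "\<tau> \<in> lang_of A2 s2"
      unfolding lang_of_def ev by (blast intro: lang_step)
  qed
  moreover have "X \<subseteq> ?Y" using X by (auto simp: lang_of_def)
  ultimately have "fsim_wait A1 A2 X \<subseteq> ?Y"
    unfolding fsim_wait_def by (intro lfp_lowerbound) blast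
  then show ?thesis using assms(3) by blast
qed

theorem theorem5p4:
  fixes A1 :: "('s1, 'e) buchi" and A2 :: "('s2, 'e) buchi"
  assumes "buchi_automaton A1"
    and "buchi_automaton A2"
    and "events A1 = events A2"
  shows "\<forall>(s1, s2) \<in> fsim_2delay A1 A2. lang_of A1 s1 \<subseteq> lang_of A2 s2"
proof clarify
  fix s1 s2 \<tau>
  assume "(s1, s2) \<in> fsim_2delay A1 A2" and \<tau>: "\<tau> \<in> lang_of A1 s1"
  then have "(s1, s2) \<in> fsim_wait A1 A2 (fsim_L_delay A1 A2)"
    by (simp only: fsim_2delay_def)
  then have "lang_of A1 s1 \<subseteq> lang_of A2 s2"
    by (rule fsim_wait_lang[OF assms(3), rotated]) (rule fsim_L_delay_lang[OF assms(3)])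
  with \<tau> show "\<tau> \<in> lang_of A2 s2" by (rule subsetD[rotated])
qed

end
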